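(* The family of sequences $(f_n)\in L_0^{\mathbb{N}}$ (of Lebesgue classes) such that $f_n\to 0$ in measure but $(f_n)$ does not converge almost everywhere in $[0,1]$ is maximal dense-lineable in $L_0^{\mathbb{N}}$.
   Context: Let $m$ be Lebesgue measure. $L_0$ is the vector space of all Lebesgue measurable functions $[0,1]\to\mathbb{R}$, where two functions are identified if they are equal almost everywhere. A sequence $(f_n)$ converges in measure to $f$ if $\lim_{n\to\infty}m(\{x\in[0,1]:|f_n(x)-f(x)|>\alpha\})=0$ for all $\alpha>0$. $L_0$ is endowed with the topology of convergence in measure, given by the metric $\rho(f,g)=\int_{[0,1]}\frac{|f(x)-g(x)|}{1+|f(x)-g(x)|}\,dx$, under which it is a complete metrizable separable topological vector space. $L_0^{\mathbb{N}}$ is the space of all sequences of elements of $L_0$ with the product topology; its algebraic dimension is $\mathfrak{c}$, the cardinality of the continuum. "$(f_n)$ does not converge almost everywhere in $[0,1]$" means that it is not the case that $(f_n(x))$ converges for almost every $x\in[0,1]$. A subset $A$ of a topological vector space $X$ is maximal dense-lineable in $X$ if there is a dense vector subspace $M$ of $X$ with $M\setminus\{0\}\subset A$ and $\dim(M)=\dim(X)$. *)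

theory Defs
  imports
    "HOL-Analysis.Analysis"
    "HOL-Library.Function_Algebras"
    "HOL-Library.Equipollence"
begin

section \<open>Real topological vector spaces\<close>

class real_tvs = real_vector + topological_ab_group_add +
  assumes tendsto_scaleR_Pair: "LIM x (nhds c \<times>\<^sub>F nhds v). fst x *\<^sub>R snd x :> nhds (c *\<^sub>R v)"

text \<open>The library's \<open>dim\<close> is a natural number and is 0 for every infinite-dimensional
  space, so equality of algebraic dimensions is expressed through the cardinalities of
  Hamel bases.\<close>

definition same_dimension :: "'a::real_vector set \<Rightarrow> 'b::real_vector set \<Rightarrow> bool" where
  "same_dimension V W \<longleftrightarrow>
     (\<exists>B C. independent B \<and> span B = V \<and> independent C \<and> span C = W \<and> B \<approx> C)"

definition maximal_dense_lineable :: "'a::real_tvs set \<Rightarrow> bool" where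
  "maximal_dense_lineable A \<longleftrightarrow>
     (\<exists>M. subspace M \<and> closure M = UNIV \<and> M - {0} \<subseteq> A \<and> same_dimension M (UNIV :: 'a set))"


section \<open>Products of topological vector spaces\<close>

text \<open>Vector operations are pointwise. The topology on \<open>'a \<Rightarrow> 'b\<close> is the library's, i.e. the
  product topology.\<close>

instantiation "fun" :: (type, real_vector) real_vector
begin

definition scaleR_fun :: "real \<Rightarrow> ('a \<Rightarrow> 'b) \<Rightarrow> 'a \<Rightarrow> 'b" where
  "scaleR_fun c f = (\<lambda>x. c *\<^sub>R f x)"

instance
  by standard (auto simp: scaleR_fun_def fun_eq_iff algebra_simps)

end

lemma continuous_on_UNIV_iff_nhds:
  "continuous_on UNIV f \<longleftrightarrow> (\<forall>x. filterlim f (nhds (f x)) (nhds x))"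
  by (simp add: continuous_on_def tendsto_at_iff_tendsto_nhds)

lemma continuous_on_UNIV_real_tvs:
  fixes u :: "'a::topological_space \<Rightarrow> 'b::real_tvs" and c :: "'a \<Rightarrow> real"
  assumes "continuous_on UNIV c" "continuous_on UNIV u"
  shows "continuous_on UNIV (\<lambda>x. c x *\<^sub>R u x)"
  unfolding continuous_on_UNIV_iff_nhds
proof
  fix x
  have "filterlim (\<lambda>y. (c y, u y)) (nhds (c x) \<times>\<^sub>F nhds (u x)) (nhds x)"
    using assms unfolding continuous_on_UNIV_iff_nhds by (auto intro: filterlim_Pair)
  from filterlim_compose[OF tendsto_scaleR_Pair this]
  show "filterlim (\<lambda>x. c x *\<^sub>R u x) (nhds (c x *\<^sub>R u x)) (nhds x)"
    by simp
qed

lemma continuous_on_UNIV_coord: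
  fixes g :: "'a::topological_space \<Rightarrow> 'i \<Rightarrow> 'b::topological_space"
  assumes "continuous_on UNIV g"
  shows "continuous_on UNIV (\<lambda>x. g x i)"
  using assms by (rule continuous_on_product_then_coordinatewise)

instance "fun" :: (type, real_tvs) real_tvs
proof
  fix a b :: "'a \<Rightarrow> 'b" and c :: real
  have "continuous_on UNIV (\<lambda>x::('a \<Rightarrow> 'b) \<times> ('a \<Rightarrow> 'b). fst x + snd x)"
  proof (rule continuous_on_coordinatewise_then_product)
    fix i
    have "continuous_on UNIV (\<lambda>x::('a \<Rightarrow> 'b) \<times> ('a \<Rightarrow> 'b). fst x i + snd x i)"
      by (rule continuous_on_add; rule continuous_on_UNIV_coord,
          rule continuous_on_fst[OF continuous_on_id] continuous_on_snd[OF continuous_on_id])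
    then show "continuous_on UNIV (\<lambda>x::('a \<Rightarrow> 'b) \<times> ('a \<Rightarrow> 'b). (fst x + snd x) i)"
      by (simp only: plus_fun_apply)
  qed
  then have "LIM x nhds (a, b). fst x + snd x :> nhds (fst (a, b) + snd (a, b))"
    unfolding continuous_on_UNIV_iff_nhds by (rule spec)
  then show "LIM x (nhds a \<times>\<^sub>F nhds b). fst x + snd x :> nhds (a + b)"
    by (simp only: nhds_prod fst_conv snd_conv)
  have "continuous_on UNIV (\<lambda>x::'a \<Rightarrow> 'b. - x)"
  proof (rule continuous_on_coordinatewise_then_product)
    fix i
    have "continuous_on UNIV (\<lambda>x::'a \<Rightarrow> 'b. x i)"
      by (rule continuous_on_UNIV_coord[OF continuous_on_id])
    then have "continuous_on UNIV (\<lambda>x::'a \<Rightarrow> 'b. - x i)"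
      unfolding continuous_on_def using tendsto_minus by blast
    then show "continuous_on UNIV (\<lambda>x::'a \<Rightarrow> 'b. (- x) i)"
      by (simp only: uminus_apply)
  qed
  then show "(uminus \<longlongrightarrow> - a) (nhds a)"
    unfolding continuous_on_UNIV_iff_nhds by (rule spec)
  have "continuous_on UNIV (\<lambda>x::real \<times> ('a \<Rightarrow> 'b). fst x *\<^sub>R snd x)"
  proof (rule continuous_on_coordinatewise_then_product)
    fix i
    have "continuous_on UNIV (\<lambda>x::real \<times> ('a \<Rightarrow> 'b). fst x *\<^sub>R snd x i)"
      by (rule continuous_on_UNIV_real_tvs[OF continuous_on_fst[OF continuous_on_id]
            continuous_on_UNIV_coord[OF continuous_on_snd[OF continuous_on_id]]])
    then show "continuous_on UNIV (\<lambda>x::real \<times> ('a \<Rightarrow> 'b). (fst x *\<^sub>R snd x) i)"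
      by (simp only: scaleR_fun_def)
  qed
  then have "LIM x nhds (c, a). fst x *\<^sub>R snd x :> nhds (fst (c, a) *\<^sub>R snd (c, a))"
    unfolding continuous_on_UNIV_iff_nhds by (rule spec)
  then show "LIM x (nhds c \<times>\<^sub>F nhds a). fst x *\<^sub>R snd x :> nhds (c *\<^sub>R a)"
    by (simp only: nhds_prod fst_conv snd_conv)
qed


section \<open>The space \<open>L\<^sub>0\<close>\<close>

text \<open>A function on \<open>[0,1]\<close> is represented by a total function on the reals, whose values
  outside \<open>[0,1]\<close> are irrelevant: both measurability and equality almost everywhere refer to
  \<open>lebesgue_on {0..1}\<close>. This is a partial equivalence relation, reflexive exactly on the
  Lebesgue measurable functions.\<close>

abbreviation leb01 :: "real measure" where
  "leb01 \<equiv> lebesgue_on {0..1}"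

definition ae_eq :: "(real \<Rightarrow> real) \<Rightarrow> (real \<Rightarrow> real) \<Rightarrow> bool" where
  "ae_eq f g \<longleftrightarrow> f \<in> borel_measurable leb01 \<and> g \<in> borel_measurable leb01
                 \<and> (AE x in leb01. f x = g x)"

quotient_type L0 = "real \<Rightarrow> real" / partial: ae_eq
proof (rule part_equivpI)
  show "\<exists>f. ae_eq f f"
    by (rule exI[of _ "\<lambda>_. 0"]) (simp add: ae_eq_def)
  show "symp ae_eq"
    by (auto simp: symp_def ae_eq_def)
  show "transp ae_eq"
    by (auto simp: transp_def ae_eq_def)
qed

lemma measure01: "finite_measure leb01"
  by (rule finite_measure_lebesgue_on) simp

lemma phi_mono: "0 \<le> s \<Longrightarrow> s \<le> t \<Longrightarrow> s / (1 + s) \<le> t / (1 + (t::real))"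
  by (simp add: divide_simps) (simp add: algebra_simps)

lemma phi_add: "0 \<le> s \<Longrightarrow> 0 \<le> t \<Longrightarrow> (s + t) / (1 + (s + t)) \<le> s / (1 + s) + t / (1 + (t::real))"
proof -
  assume s: "0 \<le> s" and t: "0 \<le> t"
  have "(s + t) / (1 + (s + t)) = s / (1 + (s + t)) + t / (1 + (s + t))"
    by (simp add: add_divide_distrib)
  also have "\<dots> \<le> s / (1 + s) + t / (1 + t)"
    using s t by (intro add_mono divide_left_mono mult_pos_pos) auto
  finally show ?thesis .
qed

lemma phi_le:
  fixes u v w :: real
  assumes "\<bar>u\<bar> \<le> \<bar>v\<bar> + \<bar>w\<bar>"
  shows "\<bar>u\<bar> / (1 + \<bar>u\<bar>) \<le> \<bar>v\<bar> / (1 + \<bar>v\<bar>) + \<bar>w\<bar> / (1 + \<bar>w\<bar>)"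
  using phi_mono[OF _ assms] phi_add[of "\<bar>v\<bar>" "\<bar>w\<bar>"] by simp

lemma phi_scale:
  fixes c u :: real
  shows "\<bar>c * u\<bar> / (1 + \<bar>c * u\<bar>) \<le> max 1 \<bar>c\<bar> * (\<bar>u\<bar> / (1 + \<bar>u\<bar>))"
proof -
  define k where "k = max 1 \<bar>c\<bar>"
  have k: "1 \<le> k" "\<bar>c\<bar> \<le> k" by (auto simp: k_def)
  have "\<bar>c * u\<bar> \<le> k * \<bar>u\<bar>"
    using k by (simp add: abs_mult mult_right_mono)
  then have "\<bar>c * u\<bar> / (1 + \<bar>c * u\<bar>) \<le> k * \<bar>u\<bar> / (1 + k * \<bar>u\<bar>)"
    by (intro phi_mono) auto
  also have "\<dots> \<le> k * \<bar>u\<bar> / (1 + \<bar>u\<bar>)"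
  proof (rule divide_left_mono)
    have *: "\<bar>u\<bar> \<le> k * \<bar>u\<bar>" using k mult_right_mono[of 1 k "\<bar>u\<bar>"] by simp
    then show "1 + \<bar>u\<bar> \<le> 1 + k * \<bar>u\<bar>" by simp
    show "0 \<le> k * \<bar>u\<bar>" using k by simp
    show "0 < (1 + k * \<bar>u\<bar>) * (1 + \<bar>u\<bar>)" using * by (intro mult_pos_pos) auto
  qed
  finally show ?thesis by (simp add: k_def)
qed

lemma phi_integrable:
  fixes f :: "real \<Rightarrow> real"
  assumes [measurable]: "f \<in> borel_measurable leb01"
  shows "integrable leb01 (\<lambda>x. \<bar>f x\<bar> / (1 + \<bar>f x\<bar>))"
proof (rule finite_measure.integrable_const_bound[OF measure01])
  show "AE x in leb01. norm (\<bar>f x\<bar> / (1 + \<bar>f x\<bar>)) \<le> 1"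
    by (auto intro!: AE_I2 simp: divide_simps)
qed simp

instantiation L0 :: real_vector
begin

lift_definition zero_L0 :: L0 is "\<lambda>x. 0"
  by (simp add: ae_eq_def)

lift_definition plus_L0 :: "L0 \<Rightarrow> L0 \<Rightarrow> L0" is "\<lambda>f g x. f x + g x"
  by (auto simp: ae_eq_def)

lift_definition minus_L0 :: "L0 \<Rightarrow> L0 \<Rightarrow> L0" is "\<lambda>f g x. f x - g x"
  by (auto simp: ae_eq_def)

lift_definition uminus_L0 :: "L0 \<Rightarrow> L0" is "\<lambda>f x. - f x"
  by (auto simp: ae_eq_def)

lift_definition scaleR_L0 :: "real \<Rightarrow> L0 \<Rightarrow> L0" is "\<lambda>c f x. c * f x"
  by (auto simp: ae_eq_def)

instance
  by standard (transfer; auto simp: ae_eq_def algebra_simps)+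

end

instantiation L0 :: metric_space
begin

lift_definition dist_L0 :: "L0 \<Rightarrow> L0 \<Rightarrow> real" is
  "\<lambda>f g. LINT x|leb01. \<bar>f x - g x\<bar> / (1 + \<bar>f x - g x\<bar>)"
  by (rule integral_cong_AE) (auto simp: ae_eq_def)

definition uniformity_L0 :: "(L0 \<times> L0) filter" where
  "uniformity_L0 = (INF e\<in>{0<..}. principal {(x, y). dist x y < e})"

definition open_L0 :: "L0 set \<Rightarrow> bool" where
  "open_L0 U \<longleftrightarrow> (\<forall>x\<in>U. eventually (\<lambda>(x', y). x' = x \<longrightarrow> y \<in> U) uniformity)"

instance
proof
  show "(dist x y = 0) = (x = y)" for x y :: L0
  proof transfer
    fix f g :: "real \<Rightarrow> real"
    assume "ae_eq f f" "ae_eq g g"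
    then have m[measurable]: "f \<in> borel_measurable leb01" "g \<in> borel_measurable leb01"
      by (auto simp: ae_eq_def)
    have "(LINT x|leb01. \<bar>f x - g x\<bar> / (1 + \<bar>f x - g x\<bar>)) = 0 \<longleftrightarrow>
          (AE x in leb01. \<bar>f x - g x\<bar> / (1 + \<bar>f x - g x\<bar>) = 0)"
      by (rule integral_nonneg_eq_0_iff_AE) (auto intro!: phi_integrable)
    also have "\<dots> \<longleftrightarrow> (AE x in leb01. f x = g x)"
      by (rule AE_cong) auto
    finally show "(LINT x|leb01. \<bar>f x - g x\<bar> / (1 + \<bar>f x - g x\<bar>)) = 0 \<longleftrightarrow> ae_eq f g"
      using m by (simp add: ae_eq_def)
  qed
  show "dist x y \<le> dist x z + dist y z" for x y z :: L0
  proof transfer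
    fix f g h :: "real \<Rightarrow> real"
    assume "ae_eq f f" "ae_eq g g" "ae_eq h h"
    then have [measurable]: "f \<in> borel_measurable leb01" "g \<in> borel_measurable leb01"
        "h \<in> borel_measurable leb01"
      by (auto simp: ae_eq_def)
    have "(LINT x|leb01. \<bar>f x - g x\<bar> / (1 + \<bar>f x - g x\<bar>)) \<le>
        (LINT x|leb01. \<bar>f x - h x\<bar> / (1 + \<bar>f x - h x\<bar>) + \<bar>g x - h x\<bar> / (1 + \<bar>g x - h x\<bar>))"
      by (intro integral_mono Bochner_Integration.integrable_add phi_integrable phi_le) auto
    also have "\<dots> = (LINT x|leb01. \<bar>f x - h x\<bar> / (1 + \<bar>f x - h x\<bar>)) +
        (LINT x|leb01. \<bar>g x - h x\<bar> / (1 + \<bar>g x - h x\<bar>))"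
      by (intro Bochner_Integration.integral_add phi_integrable) auto
    finally show "(LINT x|leb01. \<bar>f x - g x\<bar> / (1 + \<bar>f x - g x\<bar>)) \<le>
        (LINT x|leb01. \<bar>f x - h x\<bar> / (1 + \<bar>f x - h x\<bar>)) +
        (LINT x|leb01. \<bar>g x - h x\<bar> / (1 + \<bar>g x - h x\<bar>))" .
  qed
qed (simp_all add: uniformity_L0_def open_L0_def)

end

lemma dist_L0_translate: "dist (f + h) (g + h) = dist f (g::L0)"
  by transfer simp

lemma dist_L0_scale: "dist (c *\<^sub>R f) (c *\<^sub>R g) \<le> max 1 \<bar>c\<bar> * dist f (g::L0)"
proof transfer
  fix c and f g :: "real \<Rightarrow> real"
  assume "ae_eq f f" "ae_eq g g"
  then have [measurable]: "f \<in> borel_measurable leb01" "g \<in> borel_measurable leb01"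
    by (auto simp: ae_eq_def)
  have "(LINT x|leb01. \<bar>c * f x - c * g x\<bar> / (1 + \<bar>c * f x - c * g x\<bar>)) \<le>
      (LINT x|leb01. max 1 \<bar>c\<bar> * (\<bar>f x - g x\<bar> / (1 + \<bar>f x - g x\<bar>)))"
  proof (rule integral_mono)
    show "\<bar>c * f x - c * g x\<bar> / (1 + \<bar>c * f x - c * g x\<bar>) \<le>
        max 1 \<bar>c\<bar> * (\<bar>f x - g x\<bar> / (1 + \<bar>f x - g x\<bar>))" for x
      using phi_scale[of c "f x - g x"] by (simp add: right_diff_distrib)
  qed (intro integrable_mult_right phi_integrable; simp)+
  also have "\<dots> = max 1 \<bar>c\<bar> * (LINT x|leb01. \<bar>f x - g x\<bar> / (1 + \<bar>f x - g x\<bar>))"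
    by (rule integral_mult_right_zero)
  finally show "(LINT x|leb01. \<bar>c * f x - c * g x\<bar> / (1 + \<bar>c * f x - c * g x\<bar>)) \<le>
      max 1 \<bar>c\<bar> * (LINT x|leb01. \<bar>f x - g x\<bar> / (1 + \<bar>f x - g x\<bar>))" .
qed

lemma tendsto_scaleR_L0_zero:
  fixes v :: L0
  assumes "X \<longlonglongrightarrow> 0"
  shows "(\<lambda>n. dist (X n *\<^sub>R v) 0) \<longlonglongrightarrow> 0"
  using assms
proof (transfer fixing: X)
  fix f :: "real \<Rightarrow> real"
  assume "ae_eq f f" and X: "X \<longlonglongrightarrow> 0"
  then have [measurable]: "f \<in> borel_measurable leb01"
    by (auto simp: ae_eq_def)
  have "(\<lambda>n. LINT x|leb01. \<bar>X n * f x - 0\<bar> / (1 + \<bar>X n * f x - 0\<bar>)) \<longlonglongrightarrow> (LINT x|leb01. 0)"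
  proof (rule integral_dominated_convergence[where w = "\<lambda>_. 1"])
    show "AE x in leb01. (\<lambda>n. \<bar>X n * f x - 0\<bar> / (1 + \<bar>X n * f x - 0\<bar>)) \<longlonglongrightarrow> 0"
    proof (rule AE_I2)
      fix x
      have "(\<lambda>n. \<bar>X n * f x - 0\<bar> / (1 + \<bar>X n * f x - 0\<bar>)) \<longlonglongrightarrow> \<bar>0 * f x - 0\<bar> / (1 + \<bar>0 * f x - 0\<bar>)"
        by (intro tendsto_intros X) auto
      then show "(\<lambda>n. \<bar>X n * f x - 0\<bar> / (1 + \<bar>X n * f x - 0\<bar>)) \<longlonglongrightarrow> 0" by simp
    qed
  qed (use finite_measure.integrable_const[OF measure01] in \<open>auto simp: divide_simps\<close>)
  then show "(\<lambda>n. LINT x|leb01. \<bar>X n * f x - 0\<bar> / (1 + \<bar>X n * f x - 0\<bar>)) \<longlonglongrightarrow> 0" by simp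
qed

instance L0 :: real_tvs
proof
  fix a b :: L0 and c :: real
  have "dist (fst x + snd x) (a + b) \<le> dist (fst x) a + dist (snd x) b" for x
    using dist_triangle[of "fst x + snd x" "a + b" "a + snd x"]
      dist_L0_translate[of "fst x" "snd x" a] dist_L0_translate[of "snd x" a b]
    by (simp add: add.commute)
  then have le: "\<forall>\<^sub>F x in nhds a \<times>\<^sub>F nhds b.
      norm (dist (fst x + snd x) (a + b)) \<le> dist (fst x) a + dist (snd x) b"
    by simp
  have "(fst \<longlongrightarrow> a) (nhds a \<times>\<^sub>F nhds b)" "(snd \<longlongrightarrow> b) (nhds a \<times>\<^sub>F nhds b)"
    by (rule filterlim_fst filterlim_snd)+
  then have "((\<lambda>x. dist (fst x) a) \<longlongrightarrow> 0) (nhds a \<times>\<^sub>F nhds b)"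
    "((\<lambda>x. dist (snd x) b) \<longlongrightarrow> 0) (nhds a \<times>\<^sub>F nhds b)"
    unfolding tendsto_dist_iff[of fst] tendsto_dist_iff[of snd] by this
  then have "((\<lambda>x. dist (fst x) a + dist (snd x) b) \<longlongrightarrow> 0) (nhds a \<times>\<^sub>F nhds b)"
    by (rule tendsto_add_zero)
  with le have "((\<lambda>x. dist (fst x + snd x) (a + b)) \<longlongrightarrow> 0) (nhds a \<times>\<^sub>F nhds b)"
    by (rule Lim_null_comparison)
  then show "LIM x (nhds a \<times>\<^sub>F nhds b). fst x + snd x :> nhds (a + b)"
    by (rule tendsto_dist_iff[THEN iffD2])
  have "dist (- x) (- a) = dist x a" for x
    by (transfer) (simp add: abs_minus_commute)
  moreover have "((\<lambda>x. dist x a) \<longlongrightarrow> 0) (nhds a)"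
    by (rule tendsto_dist_iff[THEN iffD1, OF filterlim_ident])
  ultimately have "((\<lambda>x. dist (- x) (- a)) \<longlongrightarrow> 0) (nhds a)"
    by simp
  then show "(uminus \<longlongrightarrow> - a) (nhds a)"
    by (rule tendsto_dist_iff[THEN iffD2])
  have *: "dist (fst x *\<^sub>R snd x) (c *\<^sub>R a) \<le>
      max 1 \<bar>fst x\<bar> * dist (snd x) a + dist ((fst x - c) *\<^sub>R a) 0" for x
  proof -
    have "dist (fst x *\<^sub>R a) (c *\<^sub>R a) = dist ((fst x - c) *\<^sub>R a) 0"
      using dist_L0_translate[of "(fst x - c) *\<^sub>R a" "c *\<^sub>R a" 0] by (simp add: algebra_simps)
    then show ?thesis
      using dist_triangle[of "fst x *\<^sub>R snd x" "c *\<^sub>R a" "fst x *\<^sub>R a"]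
        dist_L0_scale[of "fst x" "snd x" a] by linarith
  qed
  have "isCont (\<lambda>t. dist (t *\<^sub>R a) 0) 0"
    unfolding continuous_at_sequentially using tendsto_scaleR_L0_zero by (auto simp: o_def)
  then have 1: "((\<lambda>t. dist (t *\<^sub>R a) 0) \<longlongrightarrow> 0) (nhds 0)"
    using tendsto_at_iff_tendsto_nhds[of "\<lambda>t. dist (t *\<^sub>R a) 0" 0] by (simp add: isCont_def)
  have "((\<lambda>x. fst x - c) \<longlongrightarrow> c - c) (nhds c \<times>\<^sub>F nhds a)"
    by (intro tendsto_intros filterlim_fst)
  then have "((\<lambda>x. dist ((fst x - c) *\<^sub>R a) 0) \<longlongrightarrow> 0) (nhds c \<times>\<^sub>F nhds a)"
    using filterlim_compose[OF 1, of "\<lambda>x. fst x - c"] by simp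
  moreover have "((\<lambda>x. dist (snd x) a) \<longlongrightarrow> 0) (nhds c \<times>\<^sub>F nhds a)"
    by (rule tendsto_dist_iff[THEN iffD1, OF filterlim_snd])
  then have "((\<lambda>x. max 1 \<bar>fst x\<bar> * dist (snd x) a) \<longlongrightarrow> max 1 \<bar>c\<bar> * 0) (nhds c \<times>\<^sub>F nhds a)"
    by (intro tendsto_intros filterlim_fst)
  ultimately have "((\<lambda>x. max 1 \<bar>fst x\<bar> * dist (snd x) a + dist ((fst x - c) *\<^sub>R a) 0) \<longlongrightarrow> 0)
      (nhds c \<times>\<^sub>F nhds a)"
    by (intro tendsto_add_zero) auto
  then have "((\<lambda>x. dist (fst x *\<^sub>R snd x) (c *\<^sub>R a)) \<longlongrightarrow> 0) (nhds c \<times>\<^sub>F nhds a)"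
    by (rule Lim_null_comparison[rotated]) (intro always_eventually allI, use * in simp)
  then show "LIM x (nhds c \<times>\<^sub>F nhds a). fst x *\<^sub>R snd x :> nhds (c *\<^sub>R a)"
    by (rule tendsto_dist_iff[THEN iffD2])
qed


section \<open>Modes of convergence of sequences of classes\<close>

lift_definition tendsto_in_measure :: "(nat \<Rightarrow> L0) \<Rightarrow> L0 \<Rightarrow> bool" is
  "\<lambda>f g. \<forall>\<alpha>>0. (\<lambda>n. measure leb01 {x\<in>{0..1}. \<bar>f n x - g x\<bar> > \<alpha>}) \<longlonglongrightarrow> 0"
proof -
  fix f f' :: "nat \<Rightarrow> real \<Rightarrow> real" and g g' :: "real \<Rightarrow> real"
  assume f: "\<And>n. ae_eq (f n) (f' n)" and g: "ae_eq g g'"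
  have [measurable]: "f n \<in> borel_measurable leb01" "f' n \<in> borel_measurable leb01"
      "g \<in> borel_measurable leb01" "g' \<in> borel_measurable leb01" for n
    using f g by (auto simp: ae_eq_def)
  have "measure leb01 {x\<in>space leb01. \<bar>f n x - g x\<bar> > \<alpha>} =
        measure leb01 {x\<in>space leb01. \<bar>f' n x - g' x\<bar> > \<alpha>}" for n \<alpha>
  proof (rule measure_eq_AE)
    have "AE x in leb01. f n x = f' n x" "AE x in leb01. g x = g' x"
      using f[of n] g by (simp_all add: ae_eq_def)
    then show "AE x in leb01. (x \<in> {x\<in>space leb01. \<bar>f n x - g x\<bar> > \<alpha>}) =
        (x \<in> {x\<in>space leb01. \<bar>f' n x - g' x\<bar> > \<alpha>})"
      by eventually_elim simp
  qed measurable
  then show "(\<forall>\<alpha>>0. (\<lambda>n. measure leb01 {x\<in>{0..1}. \<bar>f n x - g x\<bar> > \<alpha>}) \<longlonglongrightarrow> 0) =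
        (\<forall>\<alpha>>0. (\<lambda>n. measure leb01 {x\<in>{0..1}. \<bar>f' n x - g' x\<bar> > \<alpha>}) \<longlonglongrightarrow> 0)"
    by simp
qed

lift_definition converges_ae :: "(nat \<Rightarrow> L0) \<Rightarrow> bool" is
  "\<lambda>f. AE x in leb01. convergent (\<lambda>n. f n x)"
proof -
  fix f f' :: "nat \<Rightarrow> real \<Rightarrow> real"
  assume f: "\<And>n. ae_eq (f n) (f' n)"
  then have "AE x in leb01. \<forall>n. f n x = f' n x"
    by (simp add: ae_eq_def AE_all_countable)
  then have "AE x in leb01. convergent (\<lambda>n. f n x) \<longleftrightarrow> convergent (\<lambda>n. f' n x)"
    by eventually_elim simp
  then show "(AE x in leb01. convergent (\<lambda>n. f n x)) = (AE x in leb01. convergent (\<lambda>n. f' n x))"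
    by (rule eventually_subst)
qed

end

theory Submission
  imports Defs
begin

text \<open>Let \<open>(I\<^sub>n)\<close> be a typewriter sequence of intervals, let each of its levels carry an index, and
  let every index occur on infinitely many levels. The linear map sending \<open>h\<close> to
  \<open>(1\<^bsub>I\<^sub>n\<^esub> h\<^bsub>k(n)\<^esub>)\<close>, where \<open>k(n)\<close> is the index of the level of \<open>n\<close>, takes values that tend
  to \<open>0\<close> in measure, and if \<open>h\<close> is nonzero they oscillate between \<open>0\<close> and some \<open>h\<^sub>k(x) \<noteq> 0\<close> on a
  set of positive measure. Thus the whole space embeds linearly into the family with \<open>0\<close>
  adjoined. Since the family does not depend on initial segments, changing finitely many coordinates
  of the images of basis vectors makes the range dense.\<close>

section \<open>A lineability criterion in sequence spaces\<close>

text \<open>Lets tail agreement of two linear maps be checked on a spanning set.\<close>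

lemma subspace_tail_eq:
  fixes F G :: "'a::real_vector \<Rightarrow> nat \<Rightarrow> 'b::real_vector"
  assumes F: "linear F" and G: "linear G"
  shows "subspace {y. \<forall>\<^sub>F i in sequentially. F y i = G y i}"
proof (rule subspaceI)
  show "0 \<in> {y. \<forall>\<^sub>F i in sequentially. F y i = G y i}"
    by (simp add: linear_0[OF F] linear_0[OF G])
next
  fix x y assume "x \<in> {y. \<forall>\<^sub>F i in sequentially. F y i = G y i}"
    "y \<in> {y. \<forall>\<^sub>F i in sequentially. F y i = G y i}"
  then have "\<forall>\<^sub>F i in sequentially. F x i = G x i \<and> F y i = G y i"
    by (simp add: eventually_conj)
  then have "\<forall>\<^sub>F i in sequentially. F (x + y) i = G (x + y) i"
    by eventually_elim (simp add: linear_add[OF F] linear_add[OF G])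
  then show "x + y \<in> {y. \<forall>\<^sub>F i in sequentially. F y i = G y i}" by simp
next
  fix c x assume "x \<in> {y. \<forall>\<^sub>F i in sequentially. F y i = G y i}"
  then have "\<forall>\<^sub>F i in sequentially. F x i = G x i" by simp
  then have "\<forall>\<^sub>F i in sequentially. F (c *\<^sub>R x) i = G (c *\<^sub>R x) i"
    by eventually_elim (simp add: linear_scale[OF F] linear_scale[OF G] scaleR_fun_def)
  then show "c *\<^sub>R x \<in> {y. \<forall>\<^sub>F i in sequentially. F y i = G y i}" by simp
qed

text \<open>Likewise reduces attaining all initial segments of length \<open>N\<close> to those of a
  spanning set.\<close>

lemma subspace_initial_segment_in_range:
  fixes F :: "'a::real_vector \<Rightarrow> nat \<Rightarrow> 'b::real_vector"
  assumes F: "linear F"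
  shows "subspace {g. \<exists>y. \<forall>i<N. F y i = g i}"
proof (rule subspaceI)
  show "0 \<in> {g. \<exists>y. \<forall>i<N. F y i = g i}"
    by (auto intro!: exI[of _ 0] simp: linear_0[OF F])
next
  fix g h assume "g \<in> {g. \<exists>y. \<forall>i<N. F y i = g i}" "h \<in> {g. \<exists>y. \<forall>i<N. F y i = g i}"
  then obtain y z where "\<forall>i<N. F y i = g i" "\<forall>i<N. F z i = h i" by auto
  then show "g + h \<in> {g. \<exists>y. \<forall>i<N. F y i = g i}"
    by (auto intro!: exI[of _ "y + z"] simp: linear_add[OF F])
next
  fix c g assume "g \<in> {g. \<exists>y. \<forall>i<N. F y i = g i}"
  then obtain y where "\<forall>i<N. F y i = g i" by auto
  then show "c *\<^sub>R g \<in> {g. \<exists>y. \<forall>i<N. F y i = g i}"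
    by (auto intro!: exI[of _ "c *\<^sub>R y"] simp: linear_scale[OF F] scaleR_fun_def)
qed

text \<open>Sequences with the single nonzero entry \<open>v\<close> are independent, while a finite
  spanning set bounds the size of independent sets.\<close>

lemma infinite_spanning_set_sequences:
  fixes B :: "(nat \<Rightarrow> 'b::real_vector) set" and v :: 'b
  assumes "v \<noteq> 0" and B: "span B = UNIV"
  shows "infinite B"
proof
  assume fin: "finite B"
  define d :: "nat \<Rightarrow> nat \<Rightarrow> 'b" where "d n i = (if i = n then v else 0)" for n i
  have notin: "d n \<notin> span (d ` {..<n})" for n
  proof
    assume "d n \<in> span (d ` {..<n})"
    \<comment> \<open>Vanishing at place \<open>n\<close> defines a subspace containing every
      earlier \<open>d m\<close> but not \<open>d n\<close>.\<close>
    moreover have "span (d ` {..<n}) \<subseteq> {f. f n = 0}"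
      by (rule span_minimal) (auto simp: d_def subspace_def scaleR_fun_def)
    ultimately show False using \<open>v \<noteq> 0\<close> by (auto simp: d_def)
  qed
  have "independent (d ` {..<n}) \<and> card (d ` {..<n}) = n" for n
  proof (induction n)
    case (Suc n)
    moreover have "d n \<notin> d ` {..<n}"
      using notin[of n] by (rule contrapos_nn) (rule span_base)
    ultimately show ?case
      using notin[of n] independent_insert[of "d n" "d ` {..<n}"] by (simp add: lessThan_Suc)
  qed (simp add: independent_empty)
  then have "independent (d ` {..<Suc (card B)})" "card (d ` {..<Suc (card B)}) = Suc (card B)"
    by blast+
  then show False
    using independent_span_bound[OF fin, of "d ` {..<Suc (card B)}"] by (simp add: B)
qed

text \<open>Members agreeing with \<open>g\<close> below \<open>N\<close> converge to
  \<open>g\<close> as \<open>N\<close> grows, since each coordinate is eventually constant.\<close>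

lemma dense_if_initial_segments:
  fixes M :: "(nat \<Rightarrow> 'b::topological_space) set"
  assumes "\<And>g N. \<exists>f\<in>M. \<forall>i<N. f i = g i"
  shows "closure M = UNIV"
proof -
  have "g \<in> closure M" for g
  proof -
    have "\<forall>N. \<exists>f. f \<in> M \<and> (\<forall>i<N. f i = g i)" using assms by blast
    from choice[OF this] obtain F where F: "\<And>N. F N \<in> M" "\<And>N i. i < N \<Longrightarrow> F N i = g i"
      by blast
    have "F \<longlonglongrightarrow> g"
    proof -
      have "(\<lambda>N. F N i) \<longlonglongrightarrow> g i" for i
      proof (rule tendsto_eventually)
        show "\<forall>\<^sub>F N in sequentially. F N i = g i"
          using eventually_gt_at_top[of i] by eventually_elim (rule F(2))
      qed
      then have "limitin (product_topology (\<lambda>_. euclidean) UNIV) F g sequentially"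
        by (simp add: limitin_componentwise)
      then show ?thesis by (simp add: euclidean_product_topology)
    qed
    then show ?thesis
      using F(1) closure_subset[of M]
      by (intro Lim_in_closed_set[of "closure M" F sequentially]) (auto intro!: always_eventually)
  qed
  then show ?thesis by auto
qed

text \<open>Fix a Hamel basis \<open>B\<close> and a bijection between \<open>B\<close> and \<open>B \<times> \<nat>\<close>. If \<open>b\<close> corresponds to
  \<open>(c, n)\<close>, send \<open>b\<close> to the sequence that is \<open>c\<close> below \<open>n\<close> and \<open>F b\<close> from \<open>n\<close> on. The linear
  extension differs from \<open>F\<close> by finitely supported sequences, while its values attain every
  initial segment.\<close>

theorem maximal_dense_lineable_sequences:
  fixes A :: "(nat \<Rightarrow> 'b::real_tvs) set" and v :: 'b and F :: "(nat \<Rightarrow> 'b) \<Rightarrow> nat \<Rightarrow> 'b"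
  assumes "v \<noteq> 0" and "0 \<notin> A"
    and tail: "\<And>f g. f \<in> A \<Longrightarrow> \<forall>\<^sub>F i in sequentially. g i = f i \<Longrightarrow> g \<in> A"
    and F: "linear F" and FA: "\<And>g. g \<noteq> 0 \<Longrightarrow> F g \<in> A"
  shows "maximal_dense_lineable A"
proof -
  obtain B :: "(nat \<Rightarrow> 'b) set" where B: "independent B" "span B = UNIV"
    using maximal_independent_subset[of "UNIV :: (nat \<Rightarrow> 'b) set"] by (metis top.extremum_uniqueI)
  have inf: "infinite B"
    using infinite_spanning_set_sequences[OF \<open>v \<noteq> 0\<close> B(2)] .
  then have "(card_of (B \<times> (UNIV :: nat set)), card_of B) \<in> ordIso"
    by (intro card_of_Times_infinite_simps) (auto simp: infinite_iff_card_of_nat)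
  then obtain s where s: "bij_betw s (B \<times> (UNIV :: nat set)) B"
    using card_of_ordIso by blast
  define e where "e p = (\<lambda>i. if i < snd p then fst p i else F (s p) i)" for p :: "(nat \<Rightarrow> 'b) \<times> nat"
  obtain G where G: "linear G"
    and GB: "\<forall>b\<in>B. G b = e (inv_into (B \<times> UNIV) s b)"
    using linear_independent_extend[OF B(1), of "\<lambda>b. e (inv_into (B \<times> UNIV) s b)"] by blast
  then have Gs: "G (s p) = e p" if "p \<in> B \<times> UNIV" for p
    using GB bspec[OF bij_betwE[OF s] that] bij_betw_inv_into_left[OF s that] by simp
  have tail_G: "\<forall>\<^sub>F i in sequentially. G y i = F y i" for y
  proof -
    have "b \<in> {y. \<forall>\<^sub>F i in sequentially. G y i = F y i}" if "b \<in> B" for b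
    proof -
      obtain p where p: "p \<in> B \<times> UNIV" "b = s p"
        using \<open>b \<in> B\<close> bij_betw_imp_surj_on[OF s] by blast
      show ?thesis
        using eventually_ge_at_top[of "snd p"]
        unfolding mem_Collect_eq p(2) Gs[OF p(1)] by eventually_elim (simp add: e_def)
    qed
    then have "span B \<subseteq> {y. \<forall>\<^sub>F i in sequentially. G y i = F y i}"
      by (intro span_minimal subspace_tail_eq G F) auto
    then show ?thesis using B(2) by auto
  qed
  have GA: "G y \<in> A" if "y \<noteq> 0" for y
    using tail[OF FA[OF that] tail_G] .
  \<comment> \<open>A nonzero kernel element would put \<open>0\<close> into
    \<open>A\<close>.\<close>
  then have inj: "inj G"
    using \<open>0 \<notin> A\<close> by (metis linear_injective_0[OF G])
  have initial: "\<exists>y. \<forall>i<N. G y i = g i" for g N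
  proof -
    have "B \<subseteq> {g. \<exists>y. \<forall>i<N. G y i = g i}"
    proof
      fix b assume "b \<in> B"
      \<comment> \<open>The basis vector \<open>s (b, N)\<close> is the one whose image copies
        \<open>b\<close> below \<open>N\<close>.\<close>
      then show "b \<in> {g. \<exists>y. \<forall>i<N. G y i = g i}"
        by (auto intro!: exI[of _ "s (b, N)"] simp: Gs) (simp add: e_def)
    qed
    then have "span B \<subseteq> {g. \<exists>y. \<forall>i<N. G y i = g i}"
      by (intro span_minimal subspace_initial_segment_in_range G)
    then show ?thesis using B(2) by auto
  qed
  show ?thesis
    unfolding maximal_dense_lineable_def
  proof (intro exI conjI)
    show "subspace (range G)"
      by (rule linear_subspace_image[OF G]) simp
    show "closure (range G) = UNIV"
      by (rule dense_if_initial_segments) (use initial in blast)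
    show "range G - {0} \<subseteq> A"
    proof
      fix f assume "f \<in> range G - {0}"
      then obtain y where "f = G y" "y \<noteq> 0" using linear_0[OF G] by auto
      then show "f \<in> A" using GA by simp
    qed
    \<comment> \<open>Injectivity makes the image of the Hamel basis \<open>B\<close> a Hamel basis
      of the range.\<close>
    show "same_dimension (range G) (UNIV :: (nat \<Rightarrow> 'b) set)"
      unfolding same_dimension_def
    proof (intro exI conjI)
      show "independent (G ` B)"
        by (rule linear_independent_injective_image[OF G B(1)]) (simp add: inj B(2))
      show "span (G ` B) = range G"
        by (simp add: linear_span_image[OF G] B(2))
      show "G ` B \<approx> B"
        by (rule inj_on_image_eqpoll_self) (use inj inj_on_subset in blast)
    qed (use B in auto)
  qed
qed


section \<open>Tail invariance of the modes of convergence\<close>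

lemma tendsto_in_measure_offset:
  "tendsto_in_measure (\<lambda>n. f (n + k)) g \<longleftrightarrow> tendsto_in_measure f g"
proof -
  have "(\<lambda>n. measure leb01 {x\<in>{0..1}. \<bar>h (n + k) x - u x\<bar> > \<alpha>}) \<longlonglongrightarrow> 0 \<longleftrightarrow>
        (\<lambda>n. measure leb01 {x\<in>{0..1}. \<bar>h n x - u x\<bar> > \<alpha>}) \<longlonglongrightarrow> 0"
    for h :: "nat \<Rightarrow> real \<Rightarrow> real" and u \<alpha>
    by (rule iffI, erule LIMSEQ_offset, erule LIMSEQ_ignore_initial_segment)
  then show ?thesis by (transfer fixing: k) simp
qed

lemma converges_ae_offset: "converges_ae (\<lambda>n. f (n + k)) \<longleftrightarrow> converges_ae f"
proof -
  have "convergent (\<lambda>n. h (n + k) x) \<longleftrightarrow> convergent (\<lambda>n. h n x)" for h :: "nat \<Rightarrow> real \<Rightarrow> real" and x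
    by (rule convergent_ignore_initial_segment)
  then show ?thesis by (transfer fixing: k) simp
qed

text \<open>A long enough common shift turns sequences with equal tails into the same
  sequence.\<close>

lemma offset_invariant_tail_cong:
  assumes "\<And>f k. P (\<lambda>n. f (n + k)) = P f" and "\<forall>\<^sub>F i in sequentially. g i = f i"
  shows "P g = P f"
proof -
  obtain N where "\<And>i. i \<ge> N \<Longrightarrow> g i = f i"
    using assms(2) by (auto simp: eventually_sequentially)
  then have "(\<lambda>n. g (n + N)) = (\<lambda>n. f (n + N))" by auto
  then show ?thesis using assms(1) by metis
qed

section \<open>Modulated typewriter sequences\<close>

text \<open>The \<open>n\<close>-th interval, with \<open>prod_decode n = (a, b)\<close>, is the \<open>a\<close>-th of the \<open>s + 1\<close> equal
  parts of \<open>[0,1]\<close>, where \<open>s = a + b\<close> and \<open>a = 0, \<dots>, s\<close>.\<close>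

definition level :: "nat \<Rightarrow> nat" where
  "level n = fst (prod_decode n) + snd (prod_decode n)"

definition typewriter :: "nat \<Rightarrow> real set" where
  "typewriter n = {real (fst (prod_decode n)) / (real (level n) + 1) ..
                   (real (fst (prod_decode n)) + 1) / (real (level n) + 1)}"

lemma borel_measurable_indicator_typewriter [measurable]:
  "(indicator (typewriter n) :: real \<Rightarrow> real) \<in> borel_measurable leb01"
  by (rule measurable_restrict_space1, rule measurable_completion) (simp add: typewriter_def)

text \<open>Both decoded components are bounded by the level, so only finitely many codes lie below
  a given level.\<close>

lemma filterlim_level: "filterlim level at_top sequentially"
  unfolding filterlim_at_top
proof
  fix C
  have "n \<in> prod_encode ` ({..C} \<times> {..C})" if "level n < C" for n
  proof -
    have "n = prod_encode (prod_decode n)" by simp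
    moreover have "prod_decode n \<in> {..C} \<times> {..C}"
      using that by (cases "prod_decode n") (auto simp: level_def)
    ultimately show ?thesis by (metis imageI)
  qed
  then have "finite {n. level n < C}"
    by (intro finite_subset[of "{n. level n < C}" "prod_encode ` ({..C} \<times> {..C})"]
        finite_imageI finite_cartesian_product finite_atMost) blast
  then show "\<forall>\<^sub>F n in sequentially. C \<le> level n"
    by (simp add: eventually_cofinite not_le flip: cofinite_eq_sequentially)
qed

text \<open>The bound is the interval length; the form with a subset \<open>S\<close> suits
  superlevel sets of modulated sequences.\<close>

lemma measure_typewriter_le:
  assumes "S \<subseteq> typewriter n \<inter> {0..1}"
  shows "measure leb01 S \<le> 1 / (real (level n) + 1)"
proof -
  let ?T = "typewriter n"
  have "measure leb01 S \<le> measure leb01 (?T \<inter> {0..1})"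
    by (rule finite_measure.finite_measure_mono[OF measure01 assms])
      (auto simp: sets_restrict_space_iff typewriter_def)
  also have "\<dots> = measure lebesgue (?T \<inter> {0..1})"
    by (rule measure_restrict_space) auto
  also have "\<dots> \<le> measure lebesgue ?T"
    by (rule measure_mono_fmeasurable) (auto simp: typewriter_def)
  also have "\<dots> = 1 / (real (level n) + 1)"
    by (simp add: typewriter_def divide_right_mono flip: diff_divide_distrib)
  finally show ?thesis .
qed

text \<open>The parts of each level cover [0,1], and from level 2 on the first and last parts are
  disjoint. \<open>Q\<close> will select the levels carrying a fixed index.\<close>

lemma frequently_in_typewriter:
  assumes x: "x \<in> {0..1}" and inf: "\<exists>\<^sub>F s in sequentially. Q s"
  shows "\<exists>\<^sub>F n in sequentially. x \<in> typewriter n \<and> Q (level n)"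
    and "\<exists>\<^sub>F n in sequentially. x \<notin> typewriter n"
proof -
  \<comment> \<open>The code is \<open>triangle s + a\<close>, so intervals of high levels occur
    late.\<close>
  have enc: "prod_encode (a, s - a) \<ge> s" "level (prod_encode (a, s - a)) = s"
    if "a \<le> s" for a s
  proof -
    have "s \<le> triangle s" by (induction s) auto
    then show "prod_encode (a, s - a) \<ge> s" using that by (simp add: prod_encode_def)
    show "level (prod_encode (a, s - a)) = s" using that by (simp add: level_def)
  qed
  show "\<exists>\<^sub>F n in sequentially. x \<in> typewriter n \<and> Q (level n)"
    unfolding frequently_sequentially
  proof
    fix N
    obtain s where s: "s \<ge> N" "Q s" using inf by (auto simp: frequently_sequentially)
    \<comment> \<open>The cap at \<open>s\<close> matters for \<open>x = 1\<close>, where the floor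
      is \<open>s + 1\<close>; the closed last part contains this point.\<close>
    define a where "a = min s (nat \<lfloor>x * (real s + 1)\<rfloor>)"
    have a: "real a \<le> x * (real s + 1)" "x * (real s + 1) \<le> real a + 1"
    proof -
      have "real (nat \<lfloor>x * (real s + 1)\<rfloor>) \<le> x * (real s + 1)"
        using x by (intro of_nat_floor) simp
      then show "real a \<le> x * (real s + 1)" by (auto simp: a_def)
      have "x * (real s + 1) \<le> real s + 1" using x by (simp add: mult_left_le_one_le)
      moreover have "x * (real s + 1) \<le> real (nat \<lfloor>x * (real s + 1)\<rfloor>) + 1" by linarith
      ultimately show "x * (real s + 1) \<le> real a + 1" by (auto simp: a_def min_def)
    qed
    have "a \<le> s" by (simp add: a_def)
    then show "\<exists>n\<ge>N. x \<in> typewriter n \<and> Q (level n)"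
      using enc[of a s] s a
      by (intro exI[of _ "prod_encode (a, s - a)"]) (auto simp: typewriter_def field_simps)
  qed
  show "\<exists>\<^sub>F n in sequentially. x \<notin> typewriter n"
    unfolding frequently_sequentially
  proof
    fix N
    \<comment> \<open>From level 2 on, the last part starts strictly above 1/2 and the first ends
      strictly below it; \<open>a\<close> picks the one in the half away from
      \<open>x\<close>.\<close>
    define s :: nat where "s = max N 2"
    define a where "a = (if x \<le> 1/2 then s else 0)"
    have s: "s \<ge> N" "s \<ge> 2" and "a \<le> s" by (auto simp: s_def a_def)
    then have s': "real s \<ge> 2" by linarith
    have "x \<notin> typewriter (prod_encode (a, s - a))"
    proof (cases "x \<le> 1/2")
      case True
      have "x * (real s + 1) \<le> (real s + 1) / 2"
        using mult_right_mono[OF True, of "real s + 1"] by simp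
      also have "\<dots> < real s" using s' by simp
      finally have "x * (real s + 1) < real s" .
      then show ?thesis
        using True enc(2)[OF \<open>a \<le> s\<close>] by (auto simp: typewriter_def a_def field_simps)
    next
      case False
      have "1 < (real s + 1) / 2" using s' by simp
      also have "\<dots> < x * (real s + 1)"
        using mult_strict_right_mono[of "1/2" x "real s + 1"] False by simp
      finally have "1 < x * (real s + 1)" .
      then show ?thesis
        using False enc(2)[OF \<open>a \<le> s\<close>] by (auto simp: typewriter_def a_def field_simps)
    qed
    then show "\<exists>n\<ge>N. x \<notin> typewriter n" using enc(1)[OF \<open>a \<le> s\<close>] s(1) by (meson order_trans)
  qed
qed

text \<open>Level \<open>s\<close> carries the index \<open>fst (prod_decode s)\<close>; the codes
  of \<open>(k, N)\<close> are arbitrarily high levels with index \<open>k\<close>.\<close>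

lemma frequently_fst_prod_decode: "\<exists>\<^sub>F s in sequentially. fst (prod_decode s) = k"
  unfolding frequently_sequentially
proof
  fix N
  show "\<exists>s\<ge>N. fst (prod_decode s) = k"
    using le_prod_encode_2[of N k] by (intro exI[of _ "prod_encode (k, N)"]) auto
qed

lemma limit_eq_frequent_value:
  fixes X :: "nat \<Rightarrow> 'a::t1_space"
  assumes "X \<longlonglongrightarrow> L" and "\<exists>\<^sub>F n in sequentially. X n = c"
  shows "L = c"
proof (rule ccontr)
  assume "L \<noteq> c"
  then have "\<forall>\<^sub>F n in sequentially. X n \<noteq> c"
    by (rule tendsto_imp_eventually_ne[OF assms(1)])
  with assms(2) show False by (simp add: frequently_def)
qed

text \<open>The factor multiplying the typewriter is constant on each level, and each coordinate of
  \<open>h\<close> is used on infinitely many levels.\<close>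

lift_definition modulate :: "(nat \<Rightarrow> L0) \<Rightarrow> nat \<Rightarrow> L0" is
  "\<lambda>h n x. indicator (typewriter n) x * h (fst (prod_decode (level n))) x"
proof -
  fix f g :: "nat \<Rightarrow> real \<Rightarrow> real" and n
  assume fg: "\<And>n. ae_eq (f n) (g n)"
  from fg[of "fst (prod_decode (level n))"]
  show "ae_eq (\<lambda>x. indicator (typewriter n) x * f (fst (prod_decode (level n))) x)
      (\<lambda>x. indicator (typewriter n) x * g (fst (prod_decode (level n))) x)"
    by (auto simp: ae_eq_def)
qed

lemma linear_modulate: "linear modulate"
proof (rule linearI)
  fix f g :: "nat \<Rightarrow> L0" and c :: real
  have "modulate (\<lambda>i. f i + g i) n = modulate f n + modulate g n" for n
    by (transfer fixing: n)
      (simp add: ae_eq_def distrib_left borel_measurable_add borel_measurable_times)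
  then show "modulate (f + g) = modulate f + modulate g"
    by (simp add: fun_eq_iff plus_fun_def)
  have "modulate (\<lambda>i. c *\<^sub>R f i) n = c *\<^sub>R modulate f n" for n
    by (transfer fixing: n c) (simp add: ae_eq_def mult.left_commute borel_measurable_times)
  then show "modulate (c *\<^sub>R f) = c *\<^sub>R modulate f"
    by (simp add: fun_eq_iff scaleR_fun_def)
qed

text \<open>Whatever the values of \<open>h\<close>, the superlevel sets lie in intervals whose
  lengths tend to 0.\<close>

lemma tendsto_in_measure_modulate: "tendsto_in_measure (modulate h) 0"
proof transfer
  fix h :: "nat \<Rightarrow> real \<Rightarrow> real"
  let ?w = "\<lambda>n x. indicator (typewriter n) x * h (fst (prod_decode (level n))) x"
  show "\<forall>\<alpha>>0. (\<lambda>n. measure leb01 {x\<in>{0..1}. \<bar>?w n x - 0\<bar> > \<alpha>}) \<longlonglongrightarrow> 0"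
  proof (intro allI impI)
    fix \<alpha> :: real assume "\<alpha> > 0"
    have "(\<lambda>n. 1 / (real n + 1)) \<longlonglongrightarrow> 0"
      using LIMSEQ_inverse_real_of_nat by (simp add: inverse_eq_divide add.commute)
    from filterlim_compose[OF this filterlim_level]
    have "(\<lambda>n. 1 / (real (level n) + 1)) \<longlonglongrightarrow> 0" .
    then show "(\<lambda>n. measure leb01 {x\<in>{0..1}. \<bar>?w n x - 0\<bar> > \<alpha>}) \<longlonglongrightarrow> 0"
    proof (rule Lim_null_comparison[rotated])
      have "{x\<in>{0..1}. \<bar>?w n x - 0\<bar> > \<alpha>} \<subseteq> typewriter n \<inter> {0..1}" for n
        using \<open>\<alpha> > 0\<close> by (auto simp: indicator_def split: if_splits)
      from measure_typewriter_le[OF this]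
      show "\<forall>\<^sub>F n in sequentially. norm (measure leb01 {x\<in>{0..1}. \<bar>?w n x - 0\<bar> > \<alpha>})
          \<le> 1 / (real (level n) + 1)"
        by simp
    qed
  qed
qed

text \<open>At each \<open>x\<close> in [0,1] both values \<open>h k x\<close> and \<open>0\<close>
  occur infinitely often, so a limit equals both.\<close>

lemma converges_ae_modulate_imp_0:
  assumes "converges_ae (modulate h)"
  shows "h = 0"
proof -
  have "h k = 0" for k
    using assms
  proof (transfer fixing: k)
    fix h :: "nat \<Rightarrow> real \<Rightarrow> real"
    let ?w = "\<lambda>n x. indicator (typewriter n) x * h (fst (prod_decode (level n))) x"
    assume "pred_fun top (\<lambda>f. ae_eq f f) h"
    then have m: "h k \<in> borel_measurable leb01" by (simp add: ae_eq_def)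
    assume "AE x in leb01. convergent (\<lambda>n. ?w n x)"
    moreover have "AE x in leb01. x \<in> {0..1}" by (rule AE_I2) simp
    ultimately have "AE x in leb01. h k x = 0"
    proof eventually_elim
      case (elim x)
      note freq = frequently_in_typewriter[OF elim(2) frequently_fst_prod_decode[of k]]
      obtain L where L: "(\<lambda>n. ?w n x) \<longlonglongrightarrow> L" using elim(1) by (auto simp: convergent_def)
      have "\<exists>\<^sub>F n in sequentially. ?w n x = h k x"
        using freq(1) by (rule frequently_elim1) auto
      then have "L = h k x" by (rule limit_eq_frequent_value[OF L])
      moreover have "\<exists>\<^sub>F n in sequentially. ?w n x = 0"
        using freq(2) by (rule frequently_elim1) auto
      then have "L = 0" by (rule limit_eq_frequent_value[OF L])
      ultimately show ?case by simp
    qed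
    with m show "ae_eq (h k) (\<lambda>x. 0)" by (simp add: ae_eq_def)
  qed
  then show ?thesis by (simp add: fun_eq_iff)
qed

text \<open>The constants 1 and 0 differ everywhere, and [0,1] has positive measure.\<close>

lemma L0_nontrivial: "\<exists>v :: L0. v \<noteq> 0"
proof (transfer, intro bexI)
  have "emeasure leb01 (space leb01) = 1" by (simp add: emeasure_restrict_space)
  then show "\<not> ae_eq (\<lambda>_. 1) (\<lambda>_. 0)"
    using ae_filter_eq_bot_iff[of leb01] by (auto simp: ae_eq_def eventually_False)
qed (simp add: ae_eq_def)

theorem theorem7p1:
  shows "maximal_dense_lineable
           {f :: nat \<Rightarrow> L0. tendsto_in_measure f 0 \<and> \<not> converges_ae f}"
proof -
  obtain v :: L0 where "v \<noteq> 0" using L0_nontrivial by blast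
  then show ?thesis
  proof (rule maximal_dense_lineable_sequences[OF _ _ _ linear_modulate])
    have "converges_ae (\<lambda>_. 0)" by transfer (simp add: convergent_const)
    then show "0 \<notin> {f. tendsto_in_measure f 0 \<and> \<not> converges_ae f}"
      by (simp add: zero_fun_def)
  next
    fix f g :: "nat \<Rightarrow> L0"
    assume f: "f \<in> {f. tendsto_in_measure f 0 \<and> \<not> converges_ae f}"
      and "\<forall>\<^sub>F i in sequentially. g i = f i"
    from offset_invariant_tail_cong[of "\<lambda>f. tendsto_in_measure f 0 \<and> \<not> converges_ae f", OF _ this(2)] f
    show "g \<in> {f. tendsto_in_measure f 0 \<and> \<not> converges_ae f}"
      by (simp add: tendsto_in_measure_offset converges_ae_offset)
  next
    fix h :: "nat \<Rightarrow> L0"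
    assume "h \<noteq> 0"
    then show "modulate h \<in> {f. tendsto_in_measure f 0 \<and> \<not> converges_ae f}"
      using tendsto_in_measure_modulate converges_ae_modulate_imp_0 by blast
  qed
qed

end
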